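(* Let $p=-X^4-Y^4-2X^2Y^2+4X^2\in\mathbb{R}[X,Y]$ and $\mathscr{S}(p)=\{z\in\mathbb{R}^2\mid p(z)\ge 0\}$. Then $\mathscr{L}(p)_2=\operatorname{conv}(\mathscr{S}(p))$.
   Context: Let $\mathbb{R}[X,Y]_d$ be the space of real polynomials in $X,Y$ of degree at most $d$. For a single polynomial $p$ define $\mathrm{QM}(p)_d=\{\sigma_0+\sigma_1p\mid \sigma_0,\sigma_1\in\sum(\mathbb{R}[X,Y]_d)^2\}$, where $\sum(\mathbb{R}[X,Y]_d)^2$ is the set of finite sums of squares of elements of $\mathbb{R}[X,Y]_d$. The degree $d$ Lasserre relaxation is $\mathscr{L}(p)_d=\{z\in\mathbb{R}^2\mid \ell(z)\ge 0 \text{ for all } \ell\in \mathrm{QM}(p)_d\cap\mathbb{R}[X,Y]_1\}$. *)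

theory Defs
  imports "HOL-Analysis.Analysis" "HOL-Computational_Algebra.Polynomial"
begin

text \<open>
  The ring of real polynomials in two variables, represented as polynomials in \<open>Y\<close> whose
  coefficients are polynomials in \<open>X\<close>; the coefficient of \<open>X ^ i * Y ^ j\<close> in \<open>p\<close> is
  \<open>coeff (coeff p j) i\<close>.
\<close>

type_synonym bipoly = "real poly poly"

definition varX :: bipoly where
  "varX = [:[:0, 1:]:]"

definition varY :: bipoly where
  "varY = [:0, 1:]"

definition eval2 :: "bipoly \<Rightarrow> real \<times> real \<Rightarrow> real" where
  "eval2 p z = poly (poly p [:snd z:]) (fst z)"

text \<open>Degree means total degree.\<close>

definition polys_upto :: "nat \<Rightarrow> bipoly set" where
  "polys_upto d = {p. \<forall>i j. coeff (coeff p j) i \<noteq> 0 \<longrightarrow> i + j \<le> d}"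

definition sums_of_squares :: "bipoly set \<Rightarrow> bipoly set" where
  "sums_of_squares A = {\<Sum>f\<leftarrow>fs. f ^ 2 | fs. set fs \<subseteq> A}"

text \<open>
  The degree bound applies to the polynomials being squared, not to the products, so elements
  of \<open>QM p d\<close> need not have degree at most \<open>d\<close>.
\<close>

definition QM :: "bipoly \<Rightarrow> nat \<Rightarrow> bipoly set" where
  "QM p d = {\<sigma>0 + \<sigma>1 * p | \<sigma>0 \<sigma>1.
     \<sigma>0 \<in> sums_of_squares (polys_upto d) \<and> \<sigma>1 \<in> sums_of_squares (polys_upto d)}"

definition lasserre :: "bipoly \<Rightarrow> nat \<Rightarrow> (real \<times> real) set" where
  "lasserre p d = {z. \<forall>l \<in> QM p d \<inter> polys_upto 1. eval2 l z \<ge> 0}"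

definition nonneg_set :: "bipoly \<Rightarrow> (real \<times> real) set" where
  "nonneg_set p = {z. eval2 p z \<ge> 0}"

end

theory Submission
  imports Defs
begin

text \<open>
  Since \<open>p = (2 X)\<^sup>2 - (X\<^sup>2 + Y\<^sup>2)\<^sup>2\<close>, the set \<open>nonneg_set p\<close> is the union of the closed unit discs
  centred at \<open>(1, 0)\<close> and \<open>(-1, 0)\<close>, so its convex hull is a stadium. The supporting half-plane of
  the stadium with unit outer normal \<open>(s t, b)\<close>, where \<open>s = \<plusminus>1\<close> and \<open>t \<ge> 0\<close>, is certified by
  \<open>8 (1 + t) (1 + t - s t X - b Y) =
    (X\<^sup>2 + Y\<^sup>2 - 2 (1 + t))\<^sup>2 + 4 t (X - s (1 + t))\<^sup>2 + 4 (1 + t) (Y - b)\<^sup>2 + p\<close>.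
\<close>

lemma eval2_simps [simp]:
  "eval2 (p + q) z = eval2 p z + eval2 q z"
  "eval2 (p - q) z = eval2 p z - eval2 q z"
  "eval2 (- p) z = - eval2 p z"
  "eval2 (p * q) z = eval2 p z * eval2 q z"
  "eval2 (p ^ n) z = eval2 p z ^ n"
  "eval2 0 z = 0"
  "eval2 1 z = 1"
  "eval2 (numeral k) z = numeral k"
  "eval2 varX z = fst z"
  "eval2 varY z = snd z"
  "eval2 [:[:a:]:] z = a"
  by (simp_all add: eval2_def varX_def varY_def)

lemma polys_uptoD: "p \<in> polys_upto d \<Longrightarrow> d < i + j \<Longrightarrow> coeff (coeff p j) i = 0"
  unfolding polys_upto_def using not_le by blast

lemma polys_upto_mono: "p \<in> polys_upto d \<Longrightarrow> d \<le> e \<Longrightarrow> p \<in> polys_upto e"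
  by (force simp: polys_upto_def)

lemma polys_upto_diff: "p \<in> polys_upto d \<Longrightarrow> q \<in> polys_upto d \<Longrightarrow> p - q \<in> polys_upto d"
  unfolding polys_upto_def by (simp; metis diff_self)

lemma polys_upto_add: "p \<in> polys_upto d \<Longrightarrow> q \<in> polys_upto d \<Longrightarrow> p + q \<in> polys_upto d"
  unfolding polys_upto_def by (simp; metis add_0)

lemma polys_upto_mult:
  assumes "p \<in> polys_upto d" "q \<in> polys_upto e"
  shows "p * q \<in> polys_upto (d + e)"
proof -
  have "coeff (coeff (p * q) j) i = 0" if "d + e < i + j" for i j
  proof -
    \<comment> \<open>Since \<open>d + e < i + j\<close>, the first factor has index sum above
      \<open>d\<close> or the second above \<open>e\<close>.\<close>
    have "coeff (coeff p k) m * coeff (coeff q (j - k)) (i - m) = 0" if "k \<le> j" "m \<le> i" for k m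
      using polys_uptoD[OF assms(1), of m k] polys_uptoD[OF assms(2), of "i - m" "j - k"]
        that \<open>d + e < i + j\<close>
      by (cases "d < m + k") auto
    then show ?thesis
      by (auto simp: coeff_mult coeff_sum intro!: sum.neutral)
  qed
  then show ?thesis
    unfolding polys_upto_def using not_le_imp_less by blast
qed

lemma polys_upto_const: "[:[:a:]:] \<in> polys_upto d"
  by (auto simp: polys_upto_def coeff_pCons split: nat.splits)

lemma polys_upto_const_mult: "p \<in> polys_upto d \<Longrightarrow> [:[:a:]:] * p \<in> polys_upto d"
  using polys_upto_mult[OF polys_upto_const[of a 0]] by simp

lemma polys_upto_varX: "varX \<in> polys_upto 1"
  by (auto simp: polys_upto_def varX_def coeff_pCons split: nat.splits)

lemma polys_upto_varY: "varY \<in> polys_upto 1"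
  by (auto simp: polys_upto_def varY_def coeff_pCons split: nat.splits)

lemma polys_upto_1E:
  assumes "l \<in> polys_upto 1"
  obtains a b c where "l = [:[:a, b:], [:c:]:]"
proof
  show "l = [:[:coeff (coeff l 0) 0, coeff (coeff l 0) 1:], [:coeff (coeff l 1) 0:]:]"
    by (intro poly_eqI)
      (auto simp: coeff_pCons polys_uptoD[OF assms] split: nat.splits)
qed

lemma eval2_sums_of_squares_nonneg:
  assumes "\<sigma> \<in> sums_of_squares A"
  shows "eval2 \<sigma> z \<ge> 0"
proof -
  obtain fs where "\<sigma> = (\<Sum>f\<leftarrow>fs. f ^ 2)"
    using assms by (auto simp: sums_of_squares_def)
  moreover have "eval2 (\<Sum>f\<leftarrow>fs. f ^ 2) z \<ge> 0"
    by (induction fs) auto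
  ultimately show ?thesis
    by simp
qed

text \<open>Degree at most 1 means affine, so each condition cuts out a half-plane, the empty set or
  the whole plane, and these intersect in a convex set.\<close>

lemma convex_lasserre: "convex (lasserre p d)"
proof -
  have "convex {z. eval2 l z \<ge> 0}" if "l \<in> polys_upto 1" for l
  proof -
    obtain a b c where l: "l = [:[:a, b:], [:c:]:]"
      using \<open>l \<in> polys_upto 1\<close> by (rule polys_upto_1E)
    have "{z. eval2 l z \<ge> 0} = {z. inner (b, c) z \<ge> - a}"
      by (auto simp: l eval2_def inner_prod_def algebra_simps)
    then show ?thesis
      by (simp add: convex_halfspace_ge)
  qed
  moreover have "lasserre p d = (\<Inter>l \<in> QM p d \<inter> polys_upto 1. {z. eval2 l z \<ge> 0})"
    by (auto simp: lasserre_def)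
  ultimately show ?thesis
    by (auto intro!: convex_INT)
qed

lemma nonneg_set_subset_lasserre: "nonneg_set p \<subseteq> lasserre p d"
  unfolding nonneg_set_def lasserre_def QM_def
  by (auto intro!: add_nonneg_nonneg mult_nonneg_nonneg dest: eval2_sums_of_squares_nonneg)

text \<open>The case \<open>\<sigma>1 = 1\<close>; the certificates are scaled so that
  \<open>p\<close> enters with coefficient 1.\<close>

lemma QM_I:
  assumes "set fs \<subseteq> polys_upto d"
  shows "(\<Sum>f\<leftarrow>fs. f ^ 2) + p \<in> QM p d"
proof -
  have "1 \<in> polys_upto d"
    using polys_upto_const[of 1 d] by (simp flip: one_pCons)
  then have "1 \<in> sums_of_squares (polys_upto d)"
    by (auto simp: sums_of_squares_def intro!: exI[of _ "[1]"])
  moreover have "(\<Sum>f\<leftarrow>fs. f ^ 2) \<in> sums_of_squares (polys_upto d)"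
    using assms by (auto simp: sums_of_squares_def)
  ultimately show ?thesis
    unfolding QM_def by force
qed

context
  fixes p :: bipoly
  assumes p: "p = - (varX ^ 4) - varY ^ 4 - 2 * varX ^ 2 * varY ^ 2 + 4 * varX ^ 2"
begin

lemma eval2_p: "eval2 p (x, y) = (2 * x) ^ 2 - (x ^ 2 + y ^ 2) ^ 2"
  unfolding p by (simp add: power2_eq_square power4_eq_xxxx algebra_simps)

lemma disc_subset_nonneg_set:
  assumes "(x - s) ^ 2 + y ^ 2 \<le> 1" "s ^ 2 = 1"
  shows "(x, y) \<in> nonneg_set p"
proof -
  have "x ^ 2 + y ^ 2 \<le> 2 * s * x"
    using assms by (simp add: power2_eq_square algebra_simps)
  then have "(x ^ 2 + y ^ 2) ^ 2 \<le> (2 * s * x) ^ 2"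
    by (intro power_mono) auto
  then show ?thesis
    using assms by (simp add: nonneg_set_def eval2_p power_mult_distrib)
qed

lemma supporting_halfplane_in_QM:
  assumes "s ^ 2 = 1" "t \<ge> 0" "t ^ 2 + b ^ 2 = 1"
  shows "[:[:8 * (1 + t):]:] * ([:[:1 + t:]:] - [:[:s * t:]:] * varX - [:[:b:]:] * varY) \<in> QM p 2"
    (is "?l \<in> _")
proof -
  let ?fs = "[varX * varX + varY * varY - [:[:2 * (1 + t):]:],
    [:[:2 * sqrt t:]:] * (varX - [:[:s * (1 + t):]:]),
    [:[:2 * sqrt (1 + t):]:] * (varY - [:[:b:]:])]"
  \<comment> \<open>Naming the constants turns the certificate into a polynomial identity modulo the
    two relations \<open>rel\<close>, which \<open>algebra\<close> can decide;
    \<open>t \<ge> 0\<close> lets the square roots disappear on squaring.\<close>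
  define S T B where "S = [:[:s:]:]" and "T = [:[:t:]:]" and "B = [:[:b:]:]"
  have rel: "S ^ 2 = 1" "T ^ 2 + B ^ 2 = 1"
    using assms by (simp_all add: S_def T_def B_def power2_eq_square one_pCons)
  have coeff_eqs: "[:[:1 + t:]:] = 1 + T" "[:[:8 * (1 + t):]:] = 8 * (1 + T)"
    "[:[:2 * (1 + t):]:] = 2 * (1 + T)" "[:[:s * t:]:] = S * T" "[:[:s * (1 + t):]:] = S * (1 + T)"
    "[:[:2 * sqrt t:]:] ^ 2 = 4 * T" "[:[:2 * sqrt (1 + t):]:] ^ 2 = 4 * (1 + T)"
    using \<open>t \<ge> 0\<close>
    by (simp_all add: S_def T_def one_pCons numeral_poly power2_eq_square algebra_simps)
  have "?l = (\<Sum>f\<leftarrow>?fs. f ^ 2) + p"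
    unfolding p sum_list.Cons list.map sum_list.Nil power_mult_distrib coeff_eqs B_def[symmetric]
    using rel by algebra
  moreover have "set ?fs \<subseteq> polys_upto 2"
    using polys_upto_mult[OF polys_upto_varX polys_upto_varX]
      polys_upto_mult[OF polys_upto_varY polys_upto_varY]
      polys_upto_mono[OF polys_upto_varX, of "Suc (Suc 0)"]
      polys_upto_mono[OF polys_upto_varY, of "Suc (Suc 0)"]
    by (auto simp del: mult_pCons_left simp: numeral_2_eq_2
        intro!: polys_upto_add polys_upto_diff polys_upto_const polys_upto_const_mult)
  ultimately show ?thesis
    using QM_I[of ?fs 2 p] by simp
qed

text \<open>\<open>1 + \<bar>a\<bar>\<close> is the maximum of \<open>a * x + b * y\<close> over the
  two discs. The certificate with \<open>t = \<bar>a\<bar>\<close> gives the bound after cancelling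
  the positive factor.\<close>

lemma lasserre_supporting_halfplane:
  assumes "(x, y) \<in> lasserre p 2" and ab: "a ^ 2 + b ^ 2 = 1"
  shows "a * x + b * y \<le> 1 + \<bar>a\<bar>"
proof -
  \<comment> \<open>\<open>s\<close> is the sign of \<open>a\<close>, but 1 at \<open>a = 0\<close>,
    because \<open>s ^ 2 = 1\<close> must hold.\<close>
  obtain s where s: "s ^ 2 = 1" "s * \<bar>a\<bar> = a"
    by (rule that[of "if a \<ge> 0 then 1 else - 1"]) auto
  let ?l = "[:[:8 * (1 + \<bar>a\<bar>):]:] * ([:[:1 + \<bar>a\<bar>:]:] - [:[:s * \<bar>a\<bar>:]:] * varX - [:[:b:]:] * varY)"
  have "?l \<in> QM p 2"
    using s ab by (intro supporting_halfplane_in_QM) auto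
  moreover have "?l \<in> polys_upto 1"
    by (intro polys_upto_diff polys_upto_const polys_upto_const_mult polys_upto_varX polys_upto_varY)
  ultimately have "eval2 ?l (x, y) \<ge> 0"
    using assms(1) by (auto simp: lasserre_def)
  then have "8 * (1 + \<bar>a\<bar>) * (1 + \<bar>a\<bar> - a * x - b * y) \<ge> 0"
    by (simp only: eval2_simps fst_conv snd_conv s)
  then show ?thesis
    by (auto simp: zero_le_mult_iff)
qed

text \<open>The half-plane whose normal points from the nearest point of the segment towards
  \<open>(x, y)\<close> bounds the distance \<open>r\<close> by 1. Sliding the unit disc about that
  point horizontally to both centres then exhibits \<open>(x, y)\<close> as a convex
  combination.\<close>

lemma lasserre_subset_convex_hull: "lasserre p 2 \<subseteq> convex hull (nonneg_set p)"
proof clarify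
  fix x y assume xy: "(x, y) \<in> lasserre p 2"
  \<comment> \<open>\<open>(c, 0)\<close> is the point of the segment between the two centres nearest to \<open>(x, y)\<close>.\<close>
  define c where "c = max (- 1) (min 1 x)"
  define r where "r = sqrt ((x - c) ^ 2 + y ^ 2)"
  have r2: "r ^ 2 = (x - c) ^ 2 + y ^ 2"
    by (simp add: r_def)
  have "r \<le> 1"
  proof (cases "r = 0")
    case False
    then have "r > 0"
      using r_def by (simp add: less_le)
    have "((x - c) / r) ^ 2 + (y / r) ^ 2 = 1"
      using \<open>r > 0\<close> by (simp add: power_divide flip: add_divide_distrib r2)
    then have "(x - c) / r * x + y / r * y \<le> 1 + \<bar>(x - c) / r\<bar>"
      by (rule lasserre_supporting_halfplane[OF xy])
    then have "((x - c) / r * x + y / r * y) * r \<le> (1 + \<bar>(x - c) / r\<bar>) * r"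
      using \<open>r > 0\<close> by (intro mult_right_mono) auto
    then have "(x - c) * x + y * y \<le> r + \<bar>x - c\<bar>"
      using \<open>r > 0\<close> by (simp add: distrib_right)
    \<comment> \<open>Either \<open>x = c\<close>, or \<open>x\<close> was clipped and
      \<open>c\<close> is the sign of \<open>x - c\<close>. Subtracting this from the previous bound
      leaves \<open>r ^ 2 \<le> r\<close>.\<close>
    moreover have "(x - c) * c = \<bar>x - c\<bar>"
      by (auto simp: c_def max_def min_def)
    ultimately have "r * r \<le> r * 1"
      using r2 by (simp add: power2_eq_square algebra_simps)
    then show ?thesis
      using \<open>r > 0\<close> by simp
  qed simp
  then have disc: "(x - c) ^ 2 + y ^ 2 \<le> 1"
    using r2 r_def by (metis power_le_one real_sqrt_ge_zero sum_power2_ge_zero)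
  \<comment> \<open>Horizontal shifts by \<open>1 - c\<close> and \<open>- 1 - c\<close> carry
    \<open>(c, 0)\<close> to the two centres.\<close>
  have "(x - c + 1, y) \<in> nonneg_set p" "(x - c - 1, y) \<in> nonneg_set p"
    using disc by (auto intro: disc_subset_nonneg_set[of _ 1] disc_subset_nonneg_set[of _ "- 1"])
  \<comment> \<open>The weights are those expressing \<open>c\<close> as a mean of 1 and -1; they
    are nonnegative because \<open>c\<close> lies between -1 and 1.\<close>
  then have "((1 + c) / 2) *\<^sub>R (x - c + 1, y) + ((1 - c) / 2) *\<^sub>R (x - c - 1, y)
      \<in> convex hull (nonneg_set p)"
    by (intro convexD[OF convex_convex_hull] hull_inc) (auto simp: c_def field_simps)
  moreover have "((1 + c) / 2) *\<^sub>R (x - c + 1, y) + ((1 - c) / 2) *\<^sub>R (x - c - 1, y) = (x, y)"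
    by (simp add: field_simps)
  ultimately show "(x, y) \<in> convex hull (nonneg_set p)"
    by simp
qed

end

theorem proposition4p12:
  fixes p :: bipoly
  assumes "p = - (varX ^ 4) - varY ^ 4 - 2 * varX ^ 2 * varY ^ 2 + 4 * varX ^ 2"
  shows "lasserre p 2 = convex hull (nonneg_set p)"
  \<comment> \<open>For the reverse inclusion, the relaxation is convex and contains
    \<open>nonneg_set p\<close>, hence contains its hull.\<close>
  using lasserre_subset_convex_hull[OF assms]
    hull_minimal[of "nonneg_set p" "lasserre p 2" convex]
    nonneg_set_subset_lasserre convex_lasserre
  by blast

end
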